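(* Let $n\ge 1$, let $A\in\mathbb{R}^{n\times n}$, $B_1,B_2\in\mathbb{R}^{1\times n}$ and $C\in\mathbb{R}^{1\times 1}$, and suppose that $M=\begin{bmatrix}A & B_1^T\\ B_2 & C\end{bmatrix}\in\mathbb{R}^{(n+1)\times(n+1)}$ is invertible. Put $\hat B_2=\begin{bmatrix}B_2 & C\end{bmatrix}\in\mathbb{R}^{1\times(n+1)}$ (which is nonzero), and let $\hat Z_2=Z(\hat B_2)\in\mathbb{R}^{(n+1)\times n}$ be the matrix constructed from the row vector $\hat B_2$ as described in the context. Write $\hat Z_2=\begin{bmatrix}Z_2\\ Z_C\end{bmatrix}$ with $Z_2\in\mathbb{R}^{n\times n}$ and $Z_C\in\mathbb{R}^{1\times n}$, and let $\hat A=\begin{bmatrix}A & B_1^T\\ 0&0\end{bmatrix}\in\mathbb{R}^{(n+1)\times(n+1)}$, so that the nonzero entries of $\hat A\hat Z_2$ are those of $AZ_2+B_1^TZ_C$. Then $$|\hat A\hat Z_2|=|AZ_2+B_1^TZ_C|\le 2|A|+|B_1|,$$ where $|\cdot|$ denotes the number of nonzero entries of a matrix or vector.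
   Context: For a matrix or vector $X$, $|X|$ denotes the number of nonzero entries of $X$. Construction of $Z(B)$. Let $N\ge 1$, let $B=\begin{bmatrix} b_1&b_2&\cdots&b_N\end{bmatrix}\in\mathbb{R}^{1\times N}$ have at least one nonzero entry, and let $p$ be the largest index with $b_p\ne 0$. Let $e_1,\dots,e_N$ be the standard basis of $\mathbb{R}^N$. The matrix $Z(B)\in\mathbb{R}^{N\times(N-1)}$ has columns $z_1,\dots,z_{N-1}$ given by: (i) if $k<p$ and $b_k=0$, then $z_k=e_k$; (ii) if $k<p$ and $b_k\neq 0$, then $z_k=e_k-\frac{b_k}{b_j}e_j$, where $j$ is the smallest index with $j>k$ and $b_j\ne 0$; (iii) if $p\le k\le N-1$, then $z_k=e_{k+1}$. *)

theory Defs
  imports Complex_Main "Jordan_Normal_Form.Matrix"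
begin

definition nnz :: "real mat \<Rightarrow> nat" where
  "nnz X = card {(i, j). i < dim_row X \<and> j < dim_col X \<and> X $$ (i, j) \<noteq> 0}"

definition append_cols :: "'a :: zero mat \<Rightarrow> 'a mat \<Rightarrow> 'a mat" (infixr \<open>@\<^sub>c\<close> 65) where
  "X @\<^sub>c Y = four_block_mat X Y (0\<^sub>m 0 (dim_col X)) (0\<^sub>m 0 (dim_col Y))"

text \<open>
  In the following, \<open>B\<close> is a row vector, i.e. a matrix with a single row. Indices are 0-based:
  \<open>b\<^sub>1, \<dots>, b\<^sub>N\<close> are the entries at \<open>(0, 0), \<dots>, (0, N - 1)\<close>, and \<open>e\<^sub>1, \<dots>, e\<^sub>N\<close>
  are \<open>unit_vec N 0, \<dots>, unit_vec N (N - 1)\<close>.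
\<close>

text \<open>Meaningful only if \<open>B\<close> has a nonzero entry (the \<open>Max\<close> of the empty set is unspecified).\<close>
definition last_nz :: "real mat \<Rightarrow> nat" where
  "last_nz B = Max {i. i < dim_col B \<and> B $$ (0, i) \<noteq> 0}"

text \<open>Meaningful only if there is such an index, which is the case for \<open>k < last_nz B\<close>.\<close>
definition next_nz :: "real mat \<Rightarrow> nat \<Rightarrow> nat" where
  "next_nz B k = (LEAST j. k < j \<and> j < dim_col B \<and> B $$ (0, j) \<noteq> 0)"

definition Z_col :: "real mat \<Rightarrow> nat \<Rightarrow> real vec" where
  "Z_col B k = (let N = dim_col B; j = next_nz B k in
     if k < last_nz B then
       if B $$ (0, k) = 0 then unit_vec N k
       else unit_vec N k - (B $$ (0, k) / B $$ (0, j)) \<cdot>\<^sub>v unit_vec N j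
     else unit_vec N (k + 1))"

definition Z_mat :: "real mat \<Rightarrow> real mat" where
  "Z_mat B = mat_of_cols (dim_col B) (map (Z_col B) [0..<dim_col B - 1])"

lemma Z_mat_carrier: "B \<in> carrier_mat 1 N \<Longrightarrow> Z_mat B \<in> carrier_mat N (N - 1)"
  by (auto simp: Z_mat_def)

end

theory Submission
  imports Defs
begin

text \<open>
  In a product \<open>X * Z\<close>, a nonzero entry \<open>(i, l)\<close> of \<open>X\<close> can only influence those entries \<open>(i, k)\<close>
  of the product for which \<open>Z\<close> has a nonzero entry at \<open>(l, k)\<close>. So if every row of \<open>Z\<close> has at
  most \<open>c\<close> nonzero entries, then \<open>X * Z\<close> has at most \<open>c\<close> times as many nonzero entries as \<open>X\<close>
  (\<open>nnz_mult_le\<close>).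

  The rows of \<open>Z(B)\<close> are sparse because index \<open>l\<close> enters the construction in at most two ways:
  as the leading index of a single column (column \<open>l\<close> before the last nonzero position \<open>p\<close>,
  column \<open>l - 1\<close> after it), and as the index used to eliminate the nonzero entry of \<open>B\<close> that
  immediately precedes it. From \<open>p\<close> on, only one of the two is possible: at \<open>l = p\<close> there is no
  leading occurrence, and beyond \<open>p\<close> the entries of \<open>B\<close> vanish. Hence all rows have at most two
  nonzero entries (\<open>card_Z_mat_row_le_2\<close>), and the last row, whose index is at least \<open>p\<close>, has at
  most one (\<open>card_Z_mat_row_le_1\<close>).

  The block \<open>A\<close> meets arbitrary rows of \<open>Z(B)\<close>, which gives the term \<open>2 * nnz A\<close>; the column
  \<open>B1\<^sup>T\<close> meets only the last row, which gives \<open>nnz B1\<close>.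
\<close>

section \<open>Counting nonzero entries\<close>

lemma finite_nz_entries:
  "finite {(i, j). i < dim_row X \<and> j < dim_col X \<and> X $$ (i, j) \<noteq> (0::real)}"
  by (rule finite_subset[of _ "{..<dim_row X} \<times> {..<dim_col X}"]) auto

lemma nnz_transpose: "nnz (transpose_mat X) = nnz X"
proof -
  have "bij_betw prod.swap
     {(i, j). i < dim_row X \<and> j < dim_col X \<and> X $$ (i, j) \<noteq> 0}
     {(i, j). i < dim_col X \<and> j < dim_row X \<and> transpose_mat X $$ (i, j) \<noteq> 0}"
    by (rule bij_betwI[where g = prod.swap]) auto
  then show ?thesis
    unfolding nnz_def by (simp add: bij_betw_same_card)
qed

lemma nnz_add_le:
  assumes "X \<in> carrier_mat m n" "Y \<in> carrier_mat m n"
  shows "nnz (X + Y) \<le> nnz X + nnz Y"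
proof -
  let ?S = "\<lambda>X. {(i, j). i < dim_row X \<and> j < dim_col X \<and> X $$ (i, j) \<noteq> (0::real)}"
  have "?S (X + Y) \<subseteq> ?S X \<union> ?S Y"
    using assms by auto
  then have "card (?S (X + Y)) \<le> card (?S X \<union> ?S Y)"
    by (intro card_mono finite_UnI finite_nz_entries)
  also have "\<dots> \<le> card (?S X) + card (?S Y)"
    by (rule card_Un_le)
  finally show ?thesis
    unfolding nnz_def .
qed

text \<open>
  If \<open>(i, k)\<close> is a nonzero entry of \<open>X * Z\<close>, then some summand of the scalar product is nonzero,
  so \<open>(i, k)\<close> is charged to a nonzero entry \<open>(i, l)\<close> of \<open>X\<close>; each such entry is charged at most
  as often as row \<open>l\<close> of \<open>Z\<close> has nonzero entries.
\<close>
lemma nnz_mult_le: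
  assumes X: "X \<in> carrier_mat m p" and Z: "Z \<in> carrier_mat p q"
    and rows: "\<And>l. l < p \<Longrightarrow> card {k. k < q \<and> Z $$ (l, k) \<noteq> 0} \<le> c"
  shows "nnz (X * Z) \<le> c * nnz X"
proof -
  let ?S = "{(i, j). i < dim_row X \<and> j < dim_col X \<and> X $$ (i, j) \<noteq> (0::real)}"
  let ?R = "\<lambda>l. {k. k < q \<and> Z $$ (l, k) \<noteq> 0}"
  have "{(i, k). i < dim_row (X * Z) \<and> k < dim_col (X * Z) \<and> (X * Z) $$ (i, k) \<noteq> 0}
      \<subseteq> (\<Union>(i, l)\<in>?S. {i} \<times> ?R l)" (is "?T \<subseteq> ?U")
  proof
    fix x assume "x \<in> ?T"
    then obtain i k where x: "x = (i, k)" and i: "i < m" and k: "k < q"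
      and nz: "(X * Z) $$ (i, k) \<noteq> 0"
      using X Z by auto
    have "(X * Z) $$ (i, k) = (\<Sum>l\<in>{0..<p}. X $$ (i, l) * Z $$ (l, k))"
      using X Z i k by (simp add: scalar_prod_def)
    with nz obtain l where "l < p" "X $$ (i, l) * Z $$ (l, k) \<noteq> 0"
      by (metis (no_types, lifting) atLeastLessThan_iff sum.neutral)
    then show "x \<in> ?U"
      using x i k X by auto
  qed
  moreover have "finite ?U"
    by (intro finite_UN_I finite_nz_entries) auto
  ultimately have "card ?T \<le> card ?U"
    by (rule card_mono[rotated])
  also have "\<dots> \<le> (\<Sum>(i, l)\<in>?S. card ({i} \<times> ?R l))"
    using card_UN_le[OF finite_nz_entries, of "\<lambda>(i, l). {i} \<times> ?R l" X]
    by (simp add: case_prod_unfold)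
  also have "\<dots> \<le> (\<Sum>_\<in>?S. c)"
    using X rows by (intro sum_mono) (auto simp: card_cartesian_product)
  finally show ?thesis
    unfolding nnz_def by (simp add: mult.commute)
qed

lemma nnz_append_zero_rows:
  assumes X: "X \<in> carrier_mat m n"
  shows "nnz (X @\<^sub>r 0\<^sub>m r n) = nnz X"
proof -
  have "{(i, j). i < dim_row (X @\<^sub>r 0\<^sub>m r n) \<and> j < dim_col (X @\<^sub>r 0\<^sub>m r n)
      \<and> (X @\<^sub>r 0\<^sub>m r n) $$ (i, j) \<noteq> 0}
    = {(i, j). i < dim_row X \<and> j < dim_col X \<and> X $$ (i, j) \<noteq> 0}"
    using X by (auto simp: append_rows_def split: if_splits)
  then show ?thesis
    unfolding nnz_def by simp
qed

section \<open>Sparsity of the rows of \<open>Z(B)\<close>\<close>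

lemma nonzero_row_vec_ex:
  assumes B: "B \<in> carrier_mat 1 N" and "B \<noteq> 0\<^sub>m 1 N"
  obtains i where "i < N" "B $$ (0, i) \<noteq> 0"
proof -
  have "\<exists>i<N. B $$ (0, i) \<noteq> 0"
  proof (rule ccontr)
    assume "\<not> ?thesis"
    then have "B = 0\<^sub>m 1 N"
      using B by (intro eq_matI) auto
    with assms(2) show False ..
  qed
  then show ?thesis
    using that by blast
qed

lemma last_nz_props:
  assumes B: "B \<in> carrier_mat 1 N" and nz: "B \<noteq> 0\<^sub>m 1 N"
  shows "last_nz B < N" "B $$ (0, last_nz B) \<noteq> 0"
proof -
  have "last_nz B \<in> {i. i < dim_col B \<and> B $$ (0, i) \<noteq> 0}"
    unfolding last_nz_def
  proof (rule Max_in)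
    show "{i. i < dim_col B \<and> B $$ (0, i) \<noteq> 0} \<noteq> {}"
      using nonzero_row_vec_ex[OF B nz] B by auto
  qed auto
  with B show "last_nz B < N" "B $$ (0, last_nz B) \<noteq> 0"
    by auto
qed

lemma next_nz_props:
  assumes "B \<in> carrier_mat 1 N" "B \<noteq> 0\<^sub>m 1 N" and k: "k < last_nz B"
  shows "k < next_nz B k" "next_nz B k \<le> last_nz B"
proof -
  have last: "k < last_nz B \<and> last_nz B < dim_col B \<and> B $$ (0, last_nz B) \<noteq> 0"
    using last_nz_props[OF assms(1,2)] assms(1) k by auto
  show "k < next_nz B k"
    unfolding next_nz_def using LeastI[of "\<lambda>j. k < j \<and> j < dim_col B \<and> B $$ (0, j) \<noteq> 0", OF last]
    by blast
  show "next_nz B k \<le> last_nz B"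
    unfolding next_nz_def using last by (rule Least_le)
qed

text \<open>
  For nonzero positions \<open>k < k'\<close>, the successor of \<open>k\<close> is at most \<open>k'\<close> and hence lies before the
  successor of \<open>k'\<close>. So an index eliminates only one preceding entry of \<open>B\<close>.
\<close>
lemma inj_on_next_nz:
  assumes B: "B \<in> carrier_mat 1 N" "B \<noteq> 0\<^sub>m 1 N"
  shows "inj_on (next_nz B) {k. k < last_nz B \<and> B $$ (0, k) \<noteq> 0}"
proof -
  have less: "next_nz B k < next_nz B k'"
    if "k < k'" "k' < last_nz B" "B $$ (0, k') \<noteq> 0" for k k'
  proof -
    have "next_nz B k \<le> k'"
      unfolding next_nz_def using that last_nz_props[OF B] B(1) by (intro Least_le) auto
    also have "k' < next_nz B k'"
      using next_nz_props[OF B that(2)] by simp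
    finally show ?thesis .
  qed
  show ?thesis
  proof (rule inj_onI)
    fix x y
    assume "x \<in> {k. k < last_nz B \<and> B $$ (0, k) \<noteq> 0}" "y \<in> {k. k < last_nz B \<and> B $$ (0, k) \<noteq> 0}"
      and "next_nz B x = next_nz B y"
    then show "x = y"
      using less[of x y] less[of y x] by (cases x y rule: linorder_cases) auto
  qed
qed

text \<open>
  These are the columns \<open>k\<close> of \<open>Z(B)\<close> that contain \<open>unit_vec N l\<close> as the second term, with
  coefficient \<open>- b\<^sub>k / b\<^sub>l\<close>; there is at most one because of \<open>inj_on_next_nz\<close>.
\<close>
definition prev_nz_set :: "real mat \<Rightarrow> nat \<Rightarrow> nat set" where
  "prev_nz_set B l = {k. k < last_nz B \<and> B $$ (0, k) \<noteq> 0 \<and> next_nz B k = l}"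

lemma finite_prev_nz_set: "finite (prev_nz_set B l)"
  by (rule finite_subset[of _ "{..<last_nz B}"]) (auto simp: prev_nz_set_def)

lemma card_prev_nz_set:
  assumes "B \<in> carrier_mat 1 N" "B \<noteq> 0\<^sub>m 1 N"
  shows "card (prev_nz_set B l) \<le> 1"
proof -
  have "x = y" if "x \<in> prev_nz_set B l" "y \<in> prev_nz_set B l" for x y
    using inj_onD[OF inj_on_next_nz[OF assms], of x y] that by (simp add: prev_nz_set_def)
  then show ?thesis
    by (simp add: card_le_Suc0_iff_eq finite_prev_nz_set)
qed

lemma index_Z_mat:
  assumes B: "B \<in> carrier_mat 1 N" "B \<noteq> 0\<^sub>m 1 N" and l: "l < N" and k: "k < N - 1"
  shows "Z_mat B $$ (l, k) =
    (if k < last_nz B then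
       (if l = k then 1 else 0) -
       (if B $$ (0, k) \<noteq> 0 \<and> l = next_nz B k then B $$ (0, k) / B $$ (0, l) else 0)
     else if l = k + 1 then 1 else 0)"
proof -
  have "Z_mat B $$ (l, k) = Z_col B k $ l"
    using B(1) l k by (simp add: Z_mat_def mat_of_cols_index)
  moreover have "next_nz B k < N" if "k < last_nz B"
    using next_nz_props[OF B that] last_nz_props[OF B] by simp
  ultimately show ?thesis
    using B(1) l k by (auto simp: Z_col_def Let_def)
qed

lemma Z_mat_row_support_le_last:
  assumes "B \<in> carrier_mat 1 N" "B \<noteq> 0\<^sub>m 1 N" "l < N" "l \<le> last_nz B"
  shows "{k. k < N - 1 \<and> Z_mat B $$ (l, k) \<noteq> 0} \<subseteq> {k. k = l \<and> l < last_nz B} \<union> prev_nz_set B l"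
  using assms by (auto simp: index_Z_mat prev_nz_set_def split: if_splits)

lemma Z_mat_row_support_gt_last:
  assumes B: "B \<in> carrier_mat 1 N" "B \<noteq> 0\<^sub>m 1 N" and l: "l < N" "last_nz B < l"
  shows "{k. k < N - 1 \<and> Z_mat B $$ (l, k) \<noteq> 0} \<subseteq> {l - 1}"
proof -
  have "l \<noteq> next_nz B k" if "k < last_nz B" for k
    using next_nz_props[OF B that] l by simp
  then show ?thesis
    using assms by (auto simp: index_Z_mat split: if_splits)
qed

text \<open>
  At \<open>l = last_nz B\<close> the leading occurrence is missing, since column \<open>last_nz B\<close> already belongs
  to the shifted unit vectors; after that position only the shifted unit vector remains.
\<close>
lemma card_Z_mat_row_le_1:
  assumes B: "B \<in> carrier_mat 1 N" "B \<noteq> 0\<^sub>m 1 N" and l: "l < N" "last_nz B \<le> l"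
  shows "card {k. k < N - 1 \<and> Z_mat B $$ (l, k) \<noteq> 0} \<le> 1"
proof (cases "l = last_nz B")
  case True
  then have "{k. k < N - 1 \<and> Z_mat B $$ (l, k) \<noteq> 0} \<subseteq> prev_nz_set B l"
    using Z_mat_row_support_le_last[OF B l(1)] by auto
  from card_mono[OF finite_prev_nz_set this] card_prev_nz_set[OF B, of l] show ?thesis
    by linarith
next
  case False
  then show ?thesis
    using card_mono[OF _ Z_mat_row_support_gt_last[OF B l(1)]] l(2) by simp
qed

lemma card_Z_mat_row_le_2:
  assumes B: "B \<in> carrier_mat 1 N" "B \<noteq> 0\<^sub>m 1 N" and l: "l < N"
  shows "card {k. k < N - 1 \<and> Z_mat B $$ (l, k) \<noteq> 0} \<le> 2"
proof (cases "l < last_nz B")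
  case True
  then have "{k. k < N - 1 \<and> Z_mat B $$ (l, k) \<noteq> 0} \<subseteq> insert l (prev_nz_set B l)"
    using Z_mat_row_support_le_last[OF B l] by auto
  then have "card {k. k < N - 1 \<and> Z_mat B $$ (l, k) \<noteq> 0} \<le> card (insert l (prev_nz_set B l))"
    by (intro card_mono) (simp add: finite_prev_nz_set)
  also have "\<dots> \<le> Suc (card (prev_nz_set B l))"
    by (rule card_insert_le_m1) simp_all
  also have "\<dots> \<le> 2"
    using card_prev_nz_set[OF B, of l] by simp
  finally show ?thesis .
next
  case False
  then show ?thesis
    using card_Z_mat_row_le_1[OF B l] by simp
qed

section \<open>The bordered matrix\<close>

lemma invertible_mat_row_nonzero:
  fixes M :: "'a :: semiring_1 mat"
  assumes M: "invertible_mat M" "M \<in> carrier_mat n n" and i: "i < n"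
  shows "\<exists>j<n. M $$ (i, j) \<noteq> 0"
proof (rule ccontr)
  assume zero: "\<not> ?thesis"
  obtain K where K: "M * K = 1\<^sub>m n" "K * M = 1\<^sub>m (dim_row K)"
    using M unfolding invertible_mat_def inverts_mat_def by auto
  have dim: "dim_col K = n" "dim_row K = n"
    using arg_cong[OF K(1), of dim_col] arg_cong[OF K(2), of dim_col] M(2) by simp_all
  have "(M * K) $$ (i, i) = 0"
    using M(2) i dim zero by (simp add: scalar_prod_def)
  with K(1) i show False
    by simp
qed

theorem theorem4p6:
  fixes n :: nat
    and A B1 B2 C M B2h Z2h Z2 ZC Ah :: "real mat"
  assumes "n \<ge> 1"
    and "A \<in> carrier_mat n n"
    and "B1 \<in> carrier_mat 1 n"
    and "B2 \<in> carrier_mat 1 n"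
    and "C \<in> carrier_mat 1 1"
    and "M = four_block_mat A (transpose_mat B1) B2 C"
    and "invertible_mat M"
    and "B2h = B2 @\<^sub>c C"
    and "Z2h = Z_mat B2h"
    and "Z2 \<in> carrier_mat n n"
    and "ZC \<in> carrier_mat 1 n"
    and "Z2h = Z2 @\<^sub>r ZC"
    and "Ah = four_block_mat A (transpose_mat B1) (0\<^sub>m 1 n) (0\<^sub>m 1 1)"
  shows "B2h \<noteq> 0\<^sub>m 1 (n + 1)
    \<and> nnz (Ah * Z2h) = nnz (A * Z2 + transpose_mat B1 * ZC)
    \<and> nnz (A * Z2 + transpose_mat B1 * ZC) \<le> 2 * nnz A + nnz B1"
proof -
  note A = assms(2) and B1 = assms(3) and B2 = assms(4) and C = assms(5)
    and Z2 = assms(10) and ZC = assms(11)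
  have B1T: "transpose_mat B1 \<in> carrier_mat n 1"
    using B1 by simp
  have B2h: "B2h \<in> carrier_mat 1 (n + 1)"
    unfolding assms(8) append_cols_def using B2 C by (auto intro!: carrier_matI)

  \<comment> \<open>\<open>B2h\<close> is the last row of \<open>M\<close>, and an invertible matrix has no zero row.\<close>
  have M: "M \<in> carrier_mat (n + 1) (n + 1)"
    unfolding assms(6) using A C by (rule four_block_carrier_mat)
  obtain j where j: "j < n + 1" "M $$ (n, j) \<noteq> 0"
    using invertible_mat_row_nonzero[OF assms(7) M, of n] by auto
  have "M $$ (n, j) = B2h $$ (0, j)"
    unfolding assms(6,8) append_cols_def using A B1 B2 C j(1) by auto
  then have nz: "B2h \<noteq> 0\<^sub>m 1 (n + 1)"
    using j by auto

  have prod: "Ah * Z2h = (A * Z2 + transpose_mat B1 * ZC) @\<^sub>r 0\<^sub>m 1 n"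
  proof -
    have "Ah * Z2h = four_block_mat A (transpose_mat B1) (0\<^sub>m 1 n) (0\<^sub>m 1 1)
        * four_block_mat Z2 (0\<^sub>m n 0) ZC (0\<^sub>m 1 0)"
      unfolding assms(12,13) append_rows_def using Z2 ZC by simp
    also have "\<dots> = four_block_mat (A * Z2 + transpose_mat B1 * ZC)
        (A * 0\<^sub>m n 0 + transpose_mat B1 * 0\<^sub>m 1 0)
        (0\<^sub>m 1 n * Z2 + 0\<^sub>m 1 1 * ZC) (0\<^sub>m 1 n * 0\<^sub>m n 0 + 0\<^sub>m 1 1 * 0\<^sub>m 1 0)"
      by (rule mult_four_block_mat[OF A B1T _ _ Z2 _ ZC]) auto
    also have "\<dots> = (A * Z2 + transpose_mat B1 * ZC) @\<^sub>r 0\<^sub>m 1 n"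
      unfolding append_rows_def using A B1 Z2 ZC by simp
    finally show ?thesis .
  qed
  have eq: "nnz (Ah * Z2h) = nnz (A * Z2 + transpose_mat B1 * ZC)"
    unfolding prod by (rule nnz_append_zero_rows) (use A B1T Z2 ZC in auto)

  have Z2_index: "Z2 $$ (l, k) = Z_mat B2h $$ (l, k)" if "l < n" "k < n" for l k
    unfolding assms(9)[symmetric] assms(12) append_rows_def using Z2 ZC that by simp
  have ZC_index: "ZC $$ (0, k) = Z_mat B2h $$ (n, k)" if "k < n" for k
    unfolding assms(9)[symmetric] assms(12) append_rows_def using Z2 ZC that by simp

  have "nnz (A * Z2) \<le> 2 * nnz A"
  proof (rule nnz_mult_le[OF A Z2])
    fix l assume "l < n"
    then show "card {k. k < n \<and> Z2 $$ (l, k) \<noteq> 0} \<le> 2"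
      using card_Z_mat_row_le_2[OF B2h nz, of l] by (simp add: Z2_index cong: conj_cong)
  qed
  moreover have "nnz (transpose_mat B1 * ZC) \<le> 1 * nnz (transpose_mat B1)"
  proof (rule nnz_mult_le[OF B1T ZC])
    fix l :: nat assume "l < 1"
    have "last_nz B2h \<le> n"
      using last_nz_props(1)[OF B2h nz] by simp
    then show "card {k. k < n \<and> ZC $$ (l, k) \<noteq> 0} \<le> 1"
      using card_Z_mat_row_le_1[OF B2h nz, of n] \<open>l < 1\<close> by (simp add: ZC_index cong: conj_cong)
  qed
  moreover have "nnz (A * Z2 + transpose_mat B1 * ZC) \<le> nnz (A * Z2) + nnz (transpose_mat B1 * ZC)"
    by (rule nnz_add_le) (use A B1T Z2 ZC in auto)
  ultimately have "nnz (A * Z2 + transpose_mat B1 * ZC) \<le> 2 * nnz A + nnz B1"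
    by (simp add: nnz_transpose)
  with nz eq show ?thesis
    by blast
qed

end
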